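(* For $n\in\mathbb{Z}^+$, let $A_{EQ}(n)=(A_{yes}(n),A_{no}(n))$ be the promise problem over the alphabet $\{0,1,\#\}$ with $A_{yes}(n)=\{x\#y \mid x=y,\ x,y\in\{0,1\}^n\}$ and $A_{no}(n)=\{x\#y \mid x\neq y,\ x,y\in\{0,1\}^n,\ H(x,y)=\frac{n}{2}\}$. Then for every $n\in\mathbb{Z}^+$ the promise problem $A_{EQ}(n)$ can be solved by an exact 1QCFA $\mathcal{A}(n)$ with $n$ quantum basis states and $O(n)$ classical states, whereas the number of states of any one-way deterministic finite automaton (1DFA) solving $A_{EQ}(n)$ is $2^{\Omega(n)}$.
   Context: $H(x,y)$ is the Hamming distance: the number of bit positions in which $x$ and $y$ differ. A promise problem is a pair $A=(A_{yes},A_{no})$ of disjoint subsets of $\Sigma^*$. A 1DFA solves $A$ if it accepts every $w\in A_{yes}$ and rejects every $w\in A_{no}$ (no requirement on other words). A 1QCFA $\mathcal{A}$ exactly solves $A$ if $\Pr[\mathcal{A}\text{ accepts }w]=1$ for all $w\in A_{yes}$ and $\Pr[\mathcal{A}\text{ rejects }w]=1$ for all $w\in A_{no}$. 1QCFA (one-way finite automaton with quantum and classical states, measure-once version): it has a finite set $Q$ of orthonormal quantum basis states spanning a Hilbert space $H(Q)$, a finite set $S$ of classical states (containing disjoint sets $S_{acc}$, $S_{rej}$ of accepting and rejecting states), an initial quantum state $|q_0\rangle\in Q$, an initial classical state $s_0\in S$, and an input alphabet $\Sigma$ extended by a left end-marker and a right end-marker. On input $w$ the tape contains $w$ between the two end-markers,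 and the head scans the tape once from left to right, starting at the left end-marker. At each step, if the classical state is $s$ and the scanned symbol is $\sigma$, a unitary operation $\Theta(s,\sigma)$ on $H(Q)$ is applied to the current quantum state, the classical state is updated to $\delta(s,\sigma)$, and the head moves one cell right. After the right end-marker is scanned, a projective measurement (depending on the classical state) is performed on the quantum state, and the current classical state and the measurement outcome determine the final classical state, which is accepting or rejecting. The number of quantum basis states is $|Q|=\dim H(Q)$; the number of classical states is $|S|$.
   Formalization: The 1DFA lower bound is stated only for n divisible by 4: for odd n, A_no(n) is empty and one state suffices; for n ≡ 2 mod 4, H(x,y)=n/2 is odd, so a 2-state automaton checking the parity of the number of ones solves A_EQ(n). *)

theory Defs
  imports
    "HOL-Library.Landau_Symbols"
    "Jordan_Normal_Form.Schur_Decomposition"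
begin

section \<open>Promise problems\<close>

type_synonym 'a promise_problem = "'a list set \<times> 'a list set"

definition promise_problem :: "'a promise_problem \<Rightarrow> bool" where
  "promise_problem A \<longleftrightarrow> fst A \<inter> snd A = {}"


section \<open>One-way deterministic finite automata\<close>

text \<open>States are natural numbers. Every finite automaton is isomorphic to one of this kind, and
  a fixed state type lets a bound range over all automata with a constant chosen beforehand.\<close>

record 'a dfa =
  dfa_states :: "nat set"
  dfa_init :: nat
  dfa_accepting :: "nat set"
  dfa_delta :: "nat \<Rightarrow> 'a \<Rightarrow> nat"

definition dfa :: "'a dfa \<Rightarrow> bool" where
  "dfa M \<longleftrightarrow>
     finite (dfa_states M) \<and>
     dfa_init M \<in> dfa_states M \<and>
     dfa_accepting M \<subseteq> dfa_states M \<and>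
     (\<forall>q \<in> dfa_states M. \<forall>a. dfa_delta M q a \<in> dfa_states M)"

definition dfa_accepts :: "'a dfa \<Rightarrow> 'a list \<Rightarrow> bool" where
  "dfa_accepts M w \<longleftrightarrow> foldl (dfa_delta M) (dfa_init M) w \<in> dfa_accepting M"

definition dfa_solves :: "'a dfa \<Rightarrow> 'a promise_problem \<Rightarrow> bool" where
  "dfa_solves M A \<longleftrightarrow>
     (\<forall>w \<in> fst A. dfa_accepts M w) \<and> (\<forall>w \<in> snd A. \<not> dfa_accepts M w)"


section \<open>Unitary operations and projective measurements\<close>

definition unitary_op :: "nat \<Rightarrow> complex mat \<Rightarrow> bool" where
  "unitary_op d U \<longleftrightarrow>
     U \<in> carrier_mat d d \<and> mat_adjoint U * U = 1\<^sub>m d \<and> U * mat_adjoint U = 1\<^sub>m d"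

definition projection_op :: "nat \<Rightarrow> complex mat \<Rightarrow> bool" where
  "projection_op d P \<longleftrightarrow> P \<in> carrier_mat d d \<and> mat_adjoint P = P \<and> P * P = P"

text \<open>The last conjunct says that the projections sum to the identity. It is written entrywise
  because \<^typ>\<open>complex mat\<close>, which contains matrices of all dimensions, is not a monoid under
  addition.\<close>

definition projective_measurement :: "nat \<Rightarrow> nat set \<Rightarrow> (nat \<Rightarrow> complex mat) \<Rightarrow> bool" where
  "projective_measurement d R P \<longleftrightarrow>
     finite R \<and>
     (\<forall>r \<in> R. projection_op d (P r)) \<and>
     (\<forall>r \<in> R. \<forall>r' \<in> R. r \<noteq> r' \<longrightarrow> P r * P r' = 0\<^sub>m d d) \<and>
     mat d d (\<lambda>(i, j). \<Sum>r\<in>R. P r $$ (i, j)) = 1\<^sub>m d"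


section \<open>One-way automata with quantum and classical states\<close>

datatype 'a tape_symbol = Left_End | Letter 'a | Right_End

definition tape :: "'a list \<Rightarrow> 'a tape_symbol list" where
  "tape w = Left_End # map Letter w @ [Right_End]"

text \<open>The quantum basis states are \<open>0, \<dots>, d - 1\<close> with \<open>d = q_dim M\<close>, and the basis state \<open>q\<close> is
  the unit vector \<open>unit_vec d q\<close>. In classical state \<open>s\<close>, the final measurement has the set of
  outcomes \<open>q_outcomes M s\<close> and the projections \<open>q_proj M s\<close>, and the final classical state
  after outcome \<open>r\<close> is \<open>c_final M s r\<close>.\<close>

record 'a qcfa =
  q_dim :: nat
  c_states :: "nat set"
  c_acc :: "nat set"
  c_rej :: "nat set"
  q_init :: nat
  c_init :: nat
  q_theta :: "nat \<Rightarrow> 'a tape_symbol \<Rightarrow> complex mat"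
  c_delta :: "nat \<Rightarrow> 'a tape_symbol \<Rightarrow> nat"
  q_outcomes :: "nat \<Rightarrow> nat set"
  q_proj :: "nat \<Rightarrow> nat \<Rightarrow> complex mat"
  c_final :: "nat \<Rightarrow> nat \<Rightarrow> nat"

definition qcfa :: "'a qcfa \<Rightarrow> bool" where
  "qcfa M \<longleftrightarrow>
     finite (c_states M) \<and>
     c_acc M \<subseteq> c_states M \<and> c_rej M \<subseteq> c_states M \<and> c_acc M \<inter> c_rej M = {} \<and>
     q_init M < q_dim M \<and>
     c_init M \<in> c_states M \<and>
     (\<forall>s \<in> c_states M. \<forall>\<sigma>. unitary_op (q_dim M) (q_theta M s \<sigma>)) \<and>
     (\<forall>s \<in> c_states M. \<forall>\<sigma>. c_delta M s \<sigma> \<in> c_states M) \<and>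
     (\<forall>s \<in> c_states M. projective_measurement (q_dim M) (q_outcomes M s) (q_proj M s)) \<and>
     (\<forall>s \<in> c_states M. \<forall>r \<in> q_outcomes M s. c_final M s r \<in> c_acc M \<union> c_rej M)"

definition qcfa_step ::
  "'a qcfa \<Rightarrow> nat \<times> complex vec \<Rightarrow> 'a tape_symbol \<Rightarrow> nat \<times> complex vec" where
  "qcfa_step M c \<sigma> = (c_delta M (fst c) \<sigma>, q_theta M (fst c) \<sigma> *\<^sub>v snd c)"

definition qcfa_run :: "'a qcfa \<Rightarrow> 'a list \<Rightarrow> nat \<times> complex vec" where
  "qcfa_run M w = foldl (qcfa_step M) (c_init M, unit_vec (q_dim M) (q_init M)) (tape w)"

text \<open>Born rule: the squared norm of \<open>P v\<close>.\<close>

definition outcome_prob :: "complex mat \<Rightarrow> complex vec \<Rightarrow> real" where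
  "outcome_prob P v = Re ((P *\<^sub>v v) \<bullet>c (P *\<^sub>v v))"

definition qcfa_prob :: "'a qcfa \<Rightarrow> nat set \<Rightarrow> 'a list \<Rightarrow> real" where
  "qcfa_prob M F w =
     (let (s, v) = qcfa_run M w
      in \<Sum>r \<in> {r \<in> q_outcomes M s. c_final M s r \<in> F}. outcome_prob (q_proj M s r) v)"

definition qcfa_accept_prob :: "'a qcfa \<Rightarrow> 'a list \<Rightarrow> real" where
  "qcfa_accept_prob M w = qcfa_prob M (c_acc M) w"

definition qcfa_reject_prob :: "'a qcfa \<Rightarrow> 'a list \<Rightarrow> real" where
  "qcfa_reject_prob M w = qcfa_prob M (c_rej M) w"

definition qcfa_exactly_solves :: "'a qcfa \<Rightarrow> 'a promise_problem \<Rightarrow> bool" where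
  "qcfa_exactly_solves M A \<longleftrightarrow>
     (\<forall>w \<in> fst A. qcfa_accept_prob M w = 1) \<and> (\<forall>w \<in> snd A. qcfa_reject_prob M w = 1)"


section \<open>The promise version of string equality\<close>

datatype symb = Zero | One | Hash

definition bitstrings :: "nat \<Rightarrow> symb list set" where
  "bitstrings n = {x. length x = n \<and> set x \<subseteq> {Zero, One}}"

text \<open>Only used for strings of equal length.\<close>

definition hamming_dist :: "'a list \<Rightarrow> 'a list \<Rightarrow> nat" where
  "hamming_dist x y = card {i. i < length x \<and> x ! i \<noteq> y ! i}"

text \<open>The distance \<open>n / 2\<close> is a real number, so \<open>eq_no n\<close> is empty for odd \<open>n\<close> and
  an automaton with one state solves the problem. If \<open>n mod 4 = 2\<close>, the distance is odd, and two
  states suffice: the parity of the number of ones in the word decides. An exponential lower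
  bound can therefore hold only for \<open>4 dvd n\<close>.\<close>

definition eq_yes :: "nat \<Rightarrow> symb list set" where
  "eq_yes n = {x @ [Hash] @ y | x y. x \<in> bitstrings n \<and> y \<in> bitstrings n \<and> x = y}"

definition eq_no :: "nat \<Rightarrow> symb list set" where
  "eq_no n = {x @ [Hash] @ y | x y. x \<in> bitstrings n \<and> y \<in> bitstrings n \<and> x \<noteq> y \<and>
                real (hamming_dist x y) = real n / 2}"

definition A_EQ :: "nat \<Rightarrow> symb promise_problem" where
  "A_EQ n = (eq_yes n, eq_no n)"

lemma promise_problem_A_EQ: "promise_problem (A_EQ n)"
proof -
  have "w \<notin> eq_no n" if "w \<in> eq_yes n" for w
  proof
    assume "w \<in> eq_no n"
    then obtain x y where xy: "w = x @ [Hash] @ y" "length x = n" "x \<noteq> y"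
      unfolding eq_no_def bitstrings_def by blast
    from that obtain z where z: "w = z @ [Hash] @ z" "length z = n"
      unfolding eq_yes_def bitstrings_def by blast
    from xy z have "x @ (Hash # y) = z @ (Hash # z)" "length x = length z"
      by (metis append_Cons append_Nil, simp)
    then have "x = z" "y = z" by (metis append_eq_append_conv, metis append_eq_append_conv list.inject)
    with xy show False by simp
  qed
  then show ?thesis unfolding promise_problem_def A_EQ_def by auto
qed

end

theory Submission
  imports Defs
begin

text \<open>
  Quantum automaton: at the left end-marker the state becomes the uniform superposition of the \<open>n\<close>
  basis states. Reading \<open>x # y\<close> flips the phase of basis state \<open>i\<close> once for every one among
  \<open>x\<^sub>i\<close>, \<open>y\<^sub>i\<close>. The overlap with the uniform superposition is then \<open>1 - 2 H(x, y) / n\<close>, which is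
  \<open>1\<close> if \<open>x = y\<close> and \<open>0\<close> if \<open>H(x, y) = n / 2\<close>.

  Lower bound: two words of length \<open>n = 4 k\<close> at distance \<open>2 k\<close> cannot lead a DFA to the same state.
  On words with exactly \<open>2 k\<close> ones this forbids the intersection size \<open>k\<close> within each class, and
  by a Frankl-Roedl theorem such a class is exponentially small. That theorem is proved for two
  families \<open>F\<close>, \<open>G\<close> avoiding an interval of intersection sizes, by removing one point \<open>e\<close> of the
  ground set. Write \<open>F\<^sub>0\<close>, \<open>F\<^sub>1\<close> for the members without and with \<open>e\<close> (and \<open>e\<close> removed). If none
  of the pairs \<open>(F\<^sub>0, G\<^sub>0 \<union> G\<^sub>1)\<close>, \<open>(F\<^sub>0 \<union> F\<^sub>1, G\<^sub>0)\<close>, \<open>(F\<^sub>1, G\<^sub>1)\<close> has a larger product of densities,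
  then both families split almost evenly and \<open>(F\<^sub>1, G\<^sub>0 \<inter> G\<^sub>1)\<close> is nearly as dense as \<open>(F, G)\<close>, while
  it avoids an interval that is longer by one.
\<close>

section \<open>Families avoiding an interval of intersection sizes\<close>

text \<open>Write \<open>f1\<close>, \<open>g1\<close>, \<open>gU\<close> as
  \<open>(1 + u) * f / 2\<close>, \<open>(1 + v) * g / 2\<close>, \<open>(1 + w) * g / 2\<close>
  with \<open>f\<close>, \<open>g\<close> the totals. The goal bounds (1 + u)(1 - w) = 2 - (1 - u)(1
  + w) - 2uw from below: \<open>1\<close> controls the middle term, and \<open>2\<close> with
  \<open>3\<close> keeps \<open>u\<close> small from above, which makes \<open>u * w\<close>
  negligible.\<close>

lemma forbidden_step_arith:
  fixes f0 f1 fU g0 g1 gU gI :: real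
  assumes nonneg: "0 \<le> f0" "0 \<le> f1" "0 \<le> g0" "0 \<le> g1" "0 \<le> gI"
    and fU: "f0 \<le> fU" "f1 \<le> fU" and gU: "g0 \<le> gU" "g1 \<le> gU" and gI: "gU + gI = g0 + g1"
    and pos: "0 < f0 + f1" "0 < g0 + g1"
    and 1: "4 * (f0 * gU) < 1001/1000 * ((f0 + f1) * (g0 + g1))"
    and 2: "4 * (fU * g0) < 1001/1000 * ((f0 + f1) * (g0 + g1))"
    and 3: "4 * (f1 * g1) < 1004/1000 * ((f0 + f1) * (g0 + g1))"
  shows "9989/10000 * ((f0 + f1) * (g0 + g1)) \<le> 4 * (f1 * gI)"
proof -
  define f g where "f = f0 + f1" and "g = g0 + g1"
  have fg: "0 < f" "0 < g" using pos by (auto simp: f_def g_def)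
  define u v w where "u = 2 * f1 / f - 1" and "v = 2 * g1 / g - 1" and "w = 2 * gU / g - 1"
  have e: "2 * f1 = (1 + u) * f" "2 * f0 = (1 - u) * f" "2 * g1 = (1 + v) * g" "2 * g0 = (1 - v) * g"
      "2 * gU = (1 + w) * g"
    using fg by (simp_all add: u_def v_def w_def f_def g_def field_simps)
  have e': "2 * gI = (1 - w) * g"
    using e(5) gI g_def by (simp add: algebra_simps)
  have fgp: "0 < f * g" using fg by simp
  have "4 * (f0 * gU) = (2 * f0) * (2 * gU)" by simp
  also have "\<dots> = ((1 - u) * (1 + w)) * (f * g)" by (simp add: e)
  finally have a: "(1 - u) * (1 + w) < 1001/1000"
    using 1 mult_less_cancel_right_pos[OF fgp] unfolding f_def[symmetric] g_def[symmetric] by metis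
  have "4 * (f1 * g1) = (2 * f1) * (2 * g1)" by simp
  also have "\<dots> = ((1 + u) * (1 + v)) * (f * g)" by (simp add: e)
  finally have b: "(1 + u) * (1 + v) < 1004/1000"
    using 3 mult_less_cancel_right_pos[OF fgp] unfolding f_def[symmetric] g_def[symmetric] by metis
  \<comment> \<open>The union is at least as large as the larger part, so \<open>2\<close> alone
    bounds \<open>g0\<close>.\<close>
  have "f \<le> 2 * fU" using fU f_def by simp
  hence "f * (2 * g0) \<le> 2 * fU * (2 * g0)" using nonneg by (intro mult_right_mono) auto
  also have "\<dots> < 1001/1000 * (f * g)" using 2 unfolding f_def[symmetric] g_def[symmetric] by simp
  finally have "(1 - v) * (f * g) < 1001/1000 * (f * g)" by (simp add: e mult.left_commute)
  hence "1 - v < 1001/1000" using mult_less_cancel_right_pos[OF fgp] by metis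
  hence v: "v > -1/1000" by simp
  have w: "0 \<le> w" using e(5) gU g_def fg by (simp add: w_def field_simps)
  have u1: "-1 \<le> u" "u \<le> 1" using fg nonneg by (simp_all add: u_def f_def field_simps)
  have "(1 + u) * (999/1000) \<le> (1 + u) * (1 + v)" using u1 v by (intro mult_left_mono) auto
  with b have u: "u < 51/10000" by simp
  \<comment> \<open>Only a nonnegative \<open>u\<close> can hurt; then \<open>1 - u\<close> is close
    to 1 and \<open>a\<close> forces \<open>w\<close> to be small as well.\<close>
  have uw: "u * w \<le> 51/10000 * (62/10000)"
  proof (cases "0 \<le> u")
    case True
    have "(1 - 51/10000) * (1 + w) \<le> (1 - u) * (1 + w)" using u w by (intro mult_right_mono) auto
    with a have "w \<le> 62/10000" by simp
    with u w True show ?thesis by (intro mult_mono) auto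
  next
    case False
    then have "u * w \<le> 0" using w by (simp add: mult_nonpos_nonneg)
    then show ?thesis by simp
  qed
  have "(1 + u) * (1 - w) = 2 - (1 - u) * (1 + w) - 2 * (u * w)" by (simp add: algebra_simps)
  hence "9989/10000 \<le> (1 + u) * (1 - w)" using a uw by simp
  hence "9989/10000 * (f * g) \<le> ((1 + u) * (1 - w)) * (f * g)" using fgp by (intro mult_right_mono) auto
  also have "\<dots> = (2 * f1) * (2 * gI)" by (simp add: e e')
  finally show ?thesis by (simp add: f_def g_def)
qed

text \<open>The first summand covers the runs of the recursion that end with a forbidden interval above
  \<open>0\<close>, the second those that end with one below \<open>0\<close>. The bases are the extremal ones for a density
  gain of \<open>1001/1000\<close> when the interval stays, a gain of \<open>1004/1000\<close> when it shifts and a loss of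
  \<open>9989/10000\<close> when it widens; for \<open>a = b = n / 4\<close> both summands decay exponentially in \<open>n\<close>.\<close>

definition missing_bound :: "nat \<Rightarrow> int \<Rightarrow> int \<Rightarrow> real" where
  "missing_bound n a b =
     (10010/9989) powi a * (1000/1001) ^ n + (10040/9989) powi (-b) * (10000/9989) ^ n"

lemma missing_bound_pos: "0 < missing_bound n a b"
  by (simp add: missing_bound_def add_pos_pos)

text \<open>The first summand is tight here; the second grows with \<open>n\<close> and has
  slack.\<close>

lemma missing_bound_same: "missing_bound n a b \<le> 1001/1000 * missing_bound (Suc n) a b"
proof -
  have "(10000/9989 :: real) ^ n \<le> 1001/1000 * (10000/9989) ^ Suc n" by simp
  hence "(10040/9989) powi (-b) * (10000/9989) ^ n
      \<le> (10040/9989) powi (-b) * (1001/1000 * (10000/9989) ^ Suc n :: real)"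
    by (intro mult_left_mono) auto
  thus ?thesis by (simp add: missing_bound_def algebra_simps)
qed

text \<open>Now the second summand is tight, since 1004/1000 * 10000/9989 = 10040/9989, and the
  first has slack.\<close>

lemma missing_bound_shift:
  "missing_bound n (a - 1) (b - 1) \<le> 1004/1000 * missing_bound (Suc n) a b"
proof -
  have a: "(10010/9989 :: real) powi (a - 1) = (9989/10010) * (10010/9989) powi a"
    by (simp add: power_int_diff)
  have b: "(10040/9989 :: real) powi (- (b - 1)) = (10040/9989) * (10040/9989) powi (- b)"
    using power_int_add[of "10040/9989 :: real" 1 "-b"] by simp
  have "9989/10010 * ((10010/9989) powi a * (1000/1001) ^ n)
      \<le> 1004/1001 * ((10010/9989) powi a * (1000/1001) ^ n :: real)"
    by (intro mult_right_mono) auto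
  thus ?thesis unfolding missing_bound_def a b by simp
qed

text \<open>Both summands are tight.\<close>

lemma missing_bound_widen:
  "missing_bound n (a - 1) b \<le> 9989/10000 * missing_bound (Suc n) a b"
proof -
  have a: "(10010/9989 :: real) powi (a - 1) = (9989/10010) * (10010/9989) powi a"
    by (simp add: power_int_diff)
  show ?thesis unfolding missing_bound_def a by simp
qed

text \<open>There are \<open>4 ^ card A\<close> pairs of subsets, so \<open>missing_bound\<close>
  bounds the product of the two densities. Integer endpoints let the interval move below 0, and
  \<open>a \<le> b\<close> ensures that an interval and its shift by one merge into a single
  interval.\<close>

theorem forbidden_intersections:
  fixes A :: "'a set"
  assumes "finite A" "F \<subseteq> Pow A" "G \<subseteq> Pow A" "a \<le> b"
    and "\<And>X Y. X \<in> F \<Longrightarrow> Y \<in> G \<Longrightarrow> int (card (X \<inter> Y)) \<notin> {a..b}"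
  shows "real (card F) * real (card G) \<le> 4 ^ card A * missing_bound (card A) a b"
  using assms
proof (induction A arbitrary: F G a b rule: finite_induct)
  case empty
  show ?case
  proof (cases "F = {} \<or> G = {}")
    case True
    then show ?thesis using missing_bound_pos[of 0 a b] by (auto simp: less_imp_le)
  next
    case False
    with empty have FG: "F = {{}}" "G = {{}}" by auto
    \<comment> \<open>The only intersection has size 0, so the interval lies on one side of 0, and
      the matching summand is at least 1.\<close>
    with empty.prems(4)[of "{}" "{}"] have "a \<ge> 1 \<or> - b \<ge> 1" by auto
    then have "1 \<le> missing_bound 0 a b"
    proof
      assume "a \<ge> 1"
      then have "(1 :: real) \<le> (10010/9989) powi a" by (simp add: one_le_power_int)
      then show ?thesis by (simp add: missing_bound_def add_increasing2)
    next
      assume "- b \<ge> 1"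
      then have "(1 :: real) \<le> (10040/9989) powi (- b)" by (intro one_le_power_int) auto
      then show ?thesis by (simp add: missing_bound_def add_increasing)
    qed
    with FG show ?thesis by simp
  qed
next
  case (insert e A)
  \<comment> \<open>Since \<open>e\<close> is deleted from the members of \<open>high H\<close>,
    both parts live on \<open>A\<close>.\<close>
  define low high where "low H = {X \<in> H. e \<notin> X}" and "high H = {X. e \<notin> X \<and> insert e X \<in> H}"
    for H :: "'a set set"
  have sub: "low H \<subseteq> Pow A" "high H \<subseteq> Pow A" if "H \<subseteq> Pow (insert e A)" for H
    using that insert.hyps unfolding low_def high_def by (blast dest: subsetD)+
  have fin: "finite H" if "H \<subseteq> Pow A" for H
    using that insert.hyps finite_subset by blast
  have card_split: "real (card H) = real (card (low H)) + real (card (high H))"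
    if H: "H \<subseteq> Pow (insert e A)" for H
  proof -
    have "H = low H \<union> insert e ` high H"
    proof (intro equalityI subsetI)
      fix X assume "X \<in> H"
      show "X \<in> low H \<union> insert e ` high H"
      proof (cases "e \<in> X")
        case True
        then have "X = insert e (X - {e})" by auto
        moreover from this \<open>X \<in> H\<close> have "X - {e} \<in> high H" unfolding high_def by simp
        ultimately show ?thesis by blast
      qed (use \<open>X \<in> H\<close> in \<open>simp add: low_def\<close>)
    qed (auto simp: low_def high_def)
    moreover have "low H \<inter> insert e ` high H = {}" by (auto simp: low_def)
    moreover have "inj_on (insert e) (high H)"
      unfolding high_def inj_on_def by (metis (mono_tags, lifting) insert_ident mem_Collect_eq)
    ultimately have "card H = card (low H) + card (high H)"
      using fin[OF sub(1)[OF H]] fin[OF sub(2)[OF H]]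
      by (metis card_Un_disjoint card_image finite_imageI)
    then show ?thesis by simp
  qed
  note F = sub[OF insert.prems(1)] and G = sub[OF insert.prems(2)]
  \<comment> \<open>At most one of the two original sets contains \<open>e\<close>, so restoring it
    does not change the intersection.\<close>
  have int_low: "int (card (X \<inter> Y)) \<notin> {a..b}"
    if XY: "X \<in> low F \<and> Y \<in> low G \<union> high G \<or> X \<in> low F \<union> high F \<and> Y \<in> low G" for X Y
  proof -
    have e: "e \<notin> X" "e \<notin> Y" using XY by (auto simp: low_def high_def)
    consider "X \<in> F" "Y \<in> G" | "X \<in> F" "insert e Y \<in> G" | "insert e X \<in> F" "Y \<in> G"
      using XY by (auto simp: low_def high_def)
    then show ?thesis
      using e insert.prems(4)[of X Y] insert.prems(4)[of X "insert e Y"] insert.prems(4)[of "insert e X" Y]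
      by cases (simp_all only: Int_insert_left_if0 Int_insert_right_if0 simp_thms)
  qed
  \<comment> \<open>Both original sets contain \<open>e\<close>, so the intersection has lost
    exactly this point.\<close>
  have int_high: "int (card (X \<inter> Y)) + 1 \<notin> {a..b}" if X: "X \<in> high F" and Y: "Y \<in> high G" for X Y
  proof -
    have "finite (X \<inter> Y)" using F(2) X insert.hyps(1) by (meson Pow_iff finite_Int finite_subset subsetD)
    moreover have "insert e X \<inter> insert e Y = insert e (X \<inter> Y)" "e \<notin> X \<inter> Y"
      using X by (auto simp: high_def)
    ultimately have "card (insert e X \<inter> insert e Y) = Suc (card (X \<inter> Y))" by simp
    then show ?thesis using insert.prems(4)[of "insert e X" "insert e Y"] X Y by (auto simp: high_def)
  qed
  define f0 f1 fU g0 g1 gU gI where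
    "f0 = real (card (low F))" and "f1 = real (card (high F))"
    and "fU = real (card (low F \<union> high F))"
    and "g0 = real (card (low G))" and "g1 = real (card (high G))"
    and "gU = real (card (low G \<union> high G))" and "gI = real (card (low G \<inter> high G))"
  let ?n = "card A"
  let ?B = "4 ^ Suc ?n * missing_bound (Suc ?n) a b"
  have fcard: "real (card F) = f0 + f1" and gcard: "real (card G) = g0 + g1"
    using card_split insert.prems by (simp_all add: f0_def f1_def g0_def g1_def)
  have 1: "f0 * gU \<le> 4 ^ ?n * missing_bound ?n a b"
    unfolding f0_def gU_def
    by (rule insert.IH) (use F G insert.prems(3) int_low in auto)
  have 2: "fU * g0 \<le> 4 ^ ?n * missing_bound ?n a b"
    unfolding fU_def g0_def
    by (rule insert.IH) (use F G insert.prems(3) int_low in auto)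
  have 3: "f1 * g1 \<le> 4 ^ ?n * missing_bound ?n (a - 1) (b - 1)"
    unfolding f1_def g1_def
    by (rule insert.IH) (use F G insert.prems(3) int_high in fastforce)+
  have 4: "f1 * gI \<le> 4 ^ ?n * missing_bound ?n (a - 1) b"
    unfolding f1_def gI_def
  proof (rule insert.IH)
    fix X Y assume XY: "X \<in> high F" "Y \<in> low G \<inter> high G"
    \<comment> \<open>Both \<open>Y\<close> and \<open>insert e Y\<close> belong to
      \<open>G\<close>, so the size avoids the interval and its shift down by one.\<close>
    have "int (card (X \<inter> Y)) \<notin> {a..b}" "int (card (X \<inter> Y)) + 1 \<notin> {a..b}"
      using int_low int_high XY by auto
    then show "int (card (X \<inter> Y)) \<notin> {a - 1..b}" using insert.prems(3) by auto
  qed (use F G insert.prems(3) in auto)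
  have "(f0 + f1) * (g0 + g1) \<le> ?B"
  proof (rule ccontr)
    assume "\<not> ?thesis"
    then have big: "?B < (f0 + f1) * (g0 + g1)" by simp
    have nonneg: "0 \<le> f0" "0 \<le> f1" "0 \<le> g0" "0 \<le> g1" "0 \<le> gI"
      by (simp_all add: f0_def f1_def g0_def g1_def gI_def)
    have "0 < (f0 + f1) * (g0 + g1)"
      using big missing_bound_pos[of "Suc ?n" a b] by (smt (verit) mult_pos_pos zero_less_power)
    with nonneg have pos: "0 < f0 + f1" "0 < g0 + g1" by (auto simp: zero_less_mult_iff)
    \<comment> \<open>The additional point is worth a factor 4, so failure of the bound turns each
      inductive estimate into a strict comparison with the product of the sizes.\<close>
    have le: "4 * x < c * ((f0 + f1) * (g0 + g1))"
      if "x \<le> 4 ^ ?n * y" "y \<le> c * missing_bound (Suc ?n) a b" "0 < c" for x y c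
    proof -
      have "4 * x \<le> 4 * (4 ^ ?n * (c * missing_bound (Suc ?n) a b))"
        using that by (smt (verit) mult_left_mono zero_le_power)
      also have "\<dots> = c * ?B" by simp
      also have "\<dots> < c * ((f0 + f1) * (g0 + g1))" using big that(3) by simp
      finally show ?thesis .
    qed
    have "gU + gI = g0 + g1"
      using card_Un_Int[OF fin[OF G(1)] fin[OF G(2)]] by (simp add: g0_def g1_def gU_def gI_def flip: of_nat_add)
    moreover have "f0 \<le> fU" "f1 \<le> fU" "g0 \<le> gU" "g1 \<le> gU"
      unfolding f0_def f1_def fU_def g0_def g1_def gU_def
      using F G by (auto intro!: card_mono fin)
    ultimately have "9989/10000 * ((f0 + f1) * (g0 + g1)) \<le> 4 * (f1 * gI)"
      using nonneg pos le[OF 1 missing_bound_same] le[OF 2 missing_bound_same] le[OF 3 missing_bound_shift]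
      by (intro forbidden_step_arith) simp_all
    with le[OF 4 missing_bound_widen] show False by simp
  qed
  then show ?case using insert.hyps by (simp add: fcard gcard)
qed

section \<open>Automata for string equality\<close>

definition word_of :: "nat \<Rightarrow> nat set \<Rightarrow> symb list" where
  "word_of n X = map (\<lambda>i. if i \<in> X then One else Zero) [0..<n]"

lemma word_of_in_bitstrings: "word_of n X \<in> bitstrings n"
  by (auto simp: word_of_def bitstrings_def)

text \<open>The distance is the size of the symmetric difference. For two sets of size
  \<open>2 * k\<close>, distance \<open>2 * k\<close> thus means intersection size
  \<open>k\<close>.\<close>

lemma hamming_dist_word_of:
  assumes "X \<subseteq> {..<n}" "Y \<subseteq> {..<n}"
  shows "hamming_dist (word_of n X) (word_of n Y) + 2 * card (X \<inter> Y) = card X + card Y"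
proof -
  have fin: "finite X" "finite Y" using assms finite_subset by blast+
  have "{i. i < length (word_of n X) \<and> word_of n X ! i \<noteq> word_of n Y ! i} = (X - Y) \<union> (Y - X)"
    using assms by (auto simp: word_of_def split: if_splits)
  then have "hamming_dist (word_of n X) (word_of n Y) = card (X - Y) + card (Y - X)"
    unfolding hamming_dist_def using fin by (subst card_Un_disjoint[symmetric]) auto
  moreover have "card X = card (X - Y) + card (X \<inter> Y)" "card Y = card (Y - X) + card (X \<inter> Y)"
    using card_Int_Diff[OF fin(1), of Y] card_Int_Diff[OF fin(2), of X] by (auto simp: Int_commute)
  ultimately show ?thesis by simp
qed

text \<open>Appending \<open>#\<close> and \<open>y\<close> to both prefixes yields a no-instance
  and a yes-instance that the automaton cannot tell apart.\<close>

lemma same_state_imp_not_half: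
  assumes M: "dfa_solves M (A_EQ n)" and x: "x \<in> bitstrings n" "y \<in> bitstrings n"
    and state: "foldl (dfa_delta M) (dfa_init M) x = foldl (dfa_delta M) (dfa_init M) y"
    and half: "2 * hamming_dist x y = n" and n: "n \<ge> 1"
  shows False
proof -
  have "x \<noteq> y" using half n by (auto simp: hamming_dist_def)
  moreover have "2 * real (hamming_dist x y) = real n"
    using half by (metis of_nat_mult of_nat_numeral)
  then have "real (hamming_dist x y) = real n / 2" by simp
  ultimately have "x @ [Hash] @ y \<in> eq_no n" unfolding eq_no_def using x by blast
  moreover have "y @ [Hash] @ y \<in> eq_yes n" unfolding eq_yes_def using x by auto
  moreover have "dfa_accepts M (x @ [Hash] @ y) = dfa_accepts M (y @ [Hash] @ y)"
    using state by (simp add: dfa_accepts_def)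
  ultimately show False using M by (simp add: dfa_solves_def A_EQ_def)
qed

lemma foldl_dfa_delta_in_states:
  "dfa M \<Longrightarrow> q \<in> dfa_states M \<Longrightarrow> foldl (dfa_delta M) q w \<in> dfa_states M"
  by (induction w arbitrary: q) (auto simp: dfa_def)

text \<open>Each summand is the \<open>k\<close>-th power of a constant; the larger constant is
  about 0.9993.\<close>

lemma missing_bound_quarter: "missing_bound (4 * k) (int k) (int k) \<le> 2 * (9999/10000) ^ k"
proof -
  have "((10010/9989) * (1000/1001) ^ 4 :: real) ^ k \<le> (9999/10000) ^ k"
    by (rule power_mono) (simp_all add: eval_nat_numeral)
  moreover have "((9989/10040) * (10000/9989) ^ 4 :: real) ^ k \<le> (9999/10000) ^ k"
    by (rule power_mono) (simp_all add: eval_nat_numeral)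
  moreover have "missing_bound (4 * k) (int k) (int k)
      = ((10010/9989) * (1000/1001) ^ 4) ^ k + ((9989/10040) * (10000/9989) ^ 4) ^ k"
    unfolding missing_bound_def power_mult power_int_minus power_int_of_nat power_mult_distrib
    by (simp flip: power_inverse)
  ultimately show ?thesis by linarith
qed

text \<open>Pigeonhole on the middle layer, whose size is a central binomial coefficient: the sets
  leading to one state avoid the intersection size \<open>k\<close>. Taking both families equal to
  such a cell bounds its squared size, hence the square root.\<close>

lemma dfa_states_lower_bound:
  assumes M: "dfa M" "dfa_solves M (A_EQ (4 * k))" and k: "k \<ge> 1"
  shows "4 ^ (2 * k) / (4 * real k) \<le> real (card (dfa_states M)) * (4 ^ (2 * k) * sqrt (2 * (9999/10000) ^ k))"
proof -
  define layer where "layer = {X. X \<subseteq> {..<4 * k} \<and> card X = 2 * k}"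
  define state where "state X = foldl (dfa_delta M) (dfa_init M) (word_of (4 * k) X)" for X
  define cell where "cell q = {X \<in> layer. state X = q}" for q
  have fin: "finite layer" "finite (dfa_states M)"
    using M by (auto simp: layer_def dfa_def intro: finite_subset[of _ "Pow {..<4 * k}"])
  have cell: "real (card (cell q)) \<le> 4 ^ (2 * k) * sqrt (2 * (9999/10000) ^ k)" for q
  proof (rule power2_le_imp_le)
    have "real (card (cell q)) * real (card (cell q))
        \<le> 4 ^ card {..<4 * k} * missing_bound (card {..<4 * k}) (int k) (int k)"
    proof (rule forbidden_intersections)
      fix X Y assume XY: "X \<in> cell q" "Y \<in> cell q"
      show "int (card (X \<inter> Y)) \<notin> {int k..int k}"
      proof
        assume "int (card (X \<inter> Y)) \<in> {int k..int k}"
        then have "2 * hamming_dist (word_of (4 * k) X) (word_of (4 * k) Y) = 4 * k"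
          using hamming_dist_word_of[of X "4 * k" Y] XY by (auto simp: cell_def layer_def)
        then show False
          using XY k
          by (intro same_state_imp_not_half[OF M(2) word_of_in_bitstrings word_of_in_bitstrings])
            (auto simp: cell_def state_def)
      qed
    qed (auto simp: cell_def layer_def)
    also have "\<dots> \<le> 4 ^ (4 * k) * (2 * (9999/10000) ^ k)"
      using missing_bound_quarter[of k] by simp
    also have "\<dots> = (4 ^ (2 * k) * sqrt (2 * (9999/10000) ^ k))\<^sup>2"
      by (simp add: power_mult_distrib flip: power_mult)
    finally show "(real (card (cell q)))\<^sup>2 \<le> (4 ^ (2 * k) * sqrt (2 * (9999/10000) ^ k))\<^sup>2"
      by (simp add: power2_eq_square)
  qed simp
  have "layer = (\<Union>q\<in>dfa_states M. cell q)"
    using M by (auto simp: cell_def state_def dfa_def intro!: foldl_dfa_delta_in_states[unfolded dfa_def])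
  then have "card layer \<le> (\<Sum>q\<in>dfa_states M. card (cell q))"
    using fin by (metis card_UN_le)
  then have "real (card layer) \<le> (\<Sum>q\<in>dfa_states M. real (card (cell q)))"
    by (metis of_nat_le_iff of_nat_sum)
  also have "\<dots> \<le> (\<Sum>q\<in>dfa_states M. 4 ^ (2 * k) * sqrt (2 * (9999/10000) ^ k))"
    by (intro sum_mono cell)
  finally have "real (card layer) \<le> real (card (dfa_states M)) * (4 ^ (2 * k) * sqrt (2 * (9999/10000) ^ k))"
    by simp
  moreover have "4 ^ (2 * k) / (4 * real k) \<le> real (card layer)"
    using central_binomial_lower_bound[of "2 * k"] k n_subsets[of "{..<4 * k}" "2 * k"]
    by (simp add: layer_def)
  ultimately show ?thesis by linarith
qed

lemma exponential_beats_factor: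
  "\<exists>c>0. \<forall>\<^sub>F k in sequentially. 2 powr (c * real (4 * k)) * (4 * real k * sqrt (2 * (9999/10000) ^ k)) \<le> 1"
proof -
  \<comment> \<open>This makes the exponential \<open>(9999/10000) powr (- k / 4)\<close>, which
    uses up only half of the decay supplied by the square root; the rest beats the factor
    \<open>k\<close>.\<close>
  define c where "c = log 2 (10000/9999) / 16"
  have c: "c > 0" by (simp add: c_def)
  have eq: "2 powr (c * real (4 * k)) * (4 * real k * sqrt (2 * (9999/10000) ^ k))
      = 4 * sqrt 2 * (real k * ((9999/10000) powr (1/4)) ^ k)" for k
  proof -
    have "2 powr (c * real (4 * k)) = (2 powr (log 2 (10000/9999))) powr (real k / 4)"
      by (simp only: powr_powr) (simp add: c_def mult.commute)
    also have "\<dots> = (9999/10000) powr (- real k / 4)"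
      by (simp add: powr_divide powr_minus_divide)
    finally have 1: "2 powr (c * real (4 * k)) = (9999/10000) powr (- real k / 4)" .
    have 2: "sqrt (2 * (9999/10000) ^ k) = sqrt 2 * (9999/10000) powr (real k / 2)"
      by (simp add: real_sqrt_mult powr_half_sqrt[symmetric] powr_realpow[symmetric] powr_powr)
    have "(9999/10000 :: real) powr (- real k / 4) * (9999/10000) powr (real k / 2) = ((9999/10000) powr (1/4)) ^ k"
      by (simp add: powr_add[symmetric] powr_realpow[symmetric] powr_powr)
    then show ?thesis unfolding 1 2 by (simp add: mult_ac)
  qed
  have "(\<lambda>k. real k * ((9999/10000) powr (1/4)) ^ k) \<longlonglongrightarrow> 0"
    using powr_less_mono2[of "1/4" "9999/10000" 1] by (intro powser_times_n_limit_0) simp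
  then have "(\<lambda>k. 4 * sqrt 2 * (real k * ((9999/10000) powr (1/4)) ^ k)) \<longlonglongrightarrow> 0"
    by (rule tendsto_mult_right_zero)
  then have "\<forall>\<^sub>F k in sequentially. 4 * sqrt 2 * (real k * ((9999/10000) powr (1/4)) ^ k) < 1"
    by (rule order_tendstoD) simp
  then have "\<forall>\<^sub>F k in sequentially. 2 powr (c * real (4 * k)) * (4 * real k * sqrt (2 * (9999/10000) ^ k)) \<le> 1"
    unfolding eq by (rule eventually_mono) simp
  with c show ?thesis by blast
qed

lemma dfa_exponential:
  "\<exists>c::real. c > 0 \<and> (\<forall>\<^sub>F n in sequentially. 4 dvd n \<longrightarrow>
     (\<forall>M :: symb dfa. dfa M \<and> dfa_solves M (A_EQ n) \<longrightarrow> real (card (dfa_states M)) \<ge> 2 powr (c * real n)))"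
proof -
  obtain c K where c: "c > 0"
    and K: "\<And>k. k \<ge> K \<Longrightarrow> 2 powr (c * real (4 * k)) * (4 * real k * sqrt (2 * (9999/10000) ^ k)) \<le> 1"
    using exponential_beats_factor unfolding eventually_sequentially by blast
  have "2 powr (c * real n) \<le> real (card (dfa_states M))"
    if n: "n \<ge> 4 * Suc K" "4 dvd n" and M: "dfa M" "dfa_solves M (A_EQ n)" for n and M :: "symb dfa"
  proof -
    obtain k where k: "n = 4 * k" using n(2) by (elim dvdE)
    with n have k1: "k \<ge> K" "k \<ge> 1" by auto
    define t where "t = 4 * real k * sqrt (2 * (9999/10000) ^ k)"
    have t: "t > 0" using k1 by (simp add: t_def)
    have "1 \<le> real (card (dfa_states M)) * t"
      using dfa_states_lower_bound[of M k] M k k1 by (simp add: t_def field_simps)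
    moreover have "2 powr (c * real n) * t \<le> 1" using K[OF k1(1)] by (simp add: k t_def)
    ultimately have "2 powr (c * real n) * t \<le> real (card (dfa_states M)) * t" by linarith
    then show ?thesis using t by simp
  qed
  then show ?thesis using c unfolding eventually_sequentially by blast
qed

section \<open>A real orthogonal involution\<close>

text \<open>The Householder reflection that exchanges the basis state \<open>0\<close> and the uniform superposition.
  For \<open>n = 1\<close> the second branch, which divides by \<open>0\<close>, does not occur.\<close>

definition spread_entry :: "nat \<Rightarrow> nat \<Rightarrow> nat \<Rightarrow> real" where
  "spread_entry n i j = (if i = 0 \<or> j = 0 then 1 / sqrt n
     else of_bool (i = j) - 1 / (sqrt n * (sqrt n - 1)))"

lemma spread_entry_sym: "spread_entry n i j = spread_entry n j i"
  by (auto simp: spread_entry_def)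

text \<open>Off row and column 0 the matrix is the identity minus \<open>c\<close> times the
  all-ones matrix. With \<open>m = (r + 1) * (r - 1)\<close>, every entry of the square reduces to
  \<open>m * c = (r + 1) / r\<close>.\<close>

lemma spread_entry_orthogonal:
  assumes "i < n" "j < n"
  shows "(\<Sum>k<n. spread_entry n i k * spread_entry n k j) = of_bool (i = j)"
proof (cases "n = 1")
  case True
  then show ?thesis using assms by (simp add: spread_entry_def)
next
  case False
  with assms obtain m where n: "n = Suc m" "m > 0" by (cases n) auto
  define r c where "r = sqrt n" and "c = 1 / (r * (r - 1))"
  have r: "r > 1" "r\<^sup>2 = 1 + real m" using n by (simp_all add: r_def)
  have m: "real m * c = (r + 1) / r"
  proof -
    have "real m = (r + 1) * (r - 1)" using r by (simp add: power2_eq_square algebra_simps)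
    then show ?thesis using r by (simp add: c_def)
  qed
  have entry: "spread_entry n i j = (if i = 0 \<or> j = 0 then 1 / r else of_bool (i = j) - c)" for i j
    by (simp add: spread_entry_def r_def c_def)
  have delta: "(\<Sum>k<m. of_bool (a = k) :: real) = 1" "(\<Sum>k<m. of_bool (k = a) :: real) = 1" if "a < m" for a
    using that by (simp_all add: of_bool_def)
  consider "i = 0" "j = 0" | a where "i = 0" "j = Suc a" "a < m" | a where "j = 0" "i = Suc a" "a < m"
    | a b where "i = Suc a" "j = Suc b" "a < m" "b < m"
    using assms n by (cases i; cases j) auto
  then show ?thesis
  proof cases
    case 1
    have "(\<Sum>k<n. spread_entry n i k * spread_entry n k j) = (1 + real m) / r\<^sup>2"
      using 1 by (simp add: n(1) entry[unfolded n(1)] power2_eq_square add_divide_distrib)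
    then show ?thesis using 1 r by simp
  next
    case 2
    have "(\<Sum>k<n. spread_entry n i k * spread_entry n k j)
        = 1 / r * (1 / r) + (\<Sum>k<m. 1 / r * (of_bool (k = a) - c))"
      unfolding n(1) sum.lessThan_Suc_shift using 2 by (simp add: entry[unfolded n(1)])
    also have "\<dots> = 1 / r * (1 / r + 1 - real m * c)"
      by (simp only: sum_distrib_left[symmetric] sum_subtractf delta(2)[OF 2(3)]) (simp add: algebra_simps)
    also have "\<dots> = 0" unfolding m using r by (simp add: field_simps)
    finally show ?thesis using 2 by simp
  next
    case 3
    have "(\<Sum>k<n. spread_entry n i k * spread_entry n k j)
        = 1 / r * (1 / r) + (\<Sum>k<m. 1 / r * (of_bool (a = k) - c))"
      unfolding n(1) sum.lessThan_Suc_shift using 3 by (simp add: entry[unfolded n(1)] mult.commute)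
    also have "\<dots> = 1 / r * (1 / r + 1 - real m * c)"
      by (simp only: sum_distrib_left[symmetric] sum_subtractf delta(1)[OF 3(3)]) (simp add: algebra_simps)
    also have "\<dots> = 0" unfolding m using r by (simp add: field_simps)
    finally show ?thesis using 3 by simp
  next
    case 4
    have "(\<Sum>k<n. spread_entry n i k * spread_entry n k j)
        = 1 / r * (1 / r) + (\<Sum>k<m. (of_bool (a = k) - c) * (of_bool (k = b) - c))"
      unfolding n(1) sum.lessThan_Suc_shift using 4 by (simp add: entry[unfolded n(1)])
    also have "(\<Sum>k<m. (of_bool (a = k) - c) * (of_bool (k = b) - c))
        = (\<Sum>k<m. of_bool (a = k) * of_bool (k = b) - c * of_bool (a = k) - c * of_bool (k = b) + c * c)"
      by (intro sum.cong) (simp_all add: algebra_simps)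
    also have "\<dots> = (\<Sum>k<m. of_bool (a = k) * of_bool (k = b)) - c - c + real m * c * c"
      by (simp only: sum.distrib sum_distrib_left[symmetric] sum_subtractf delta(1)[OF 4(3)] delta(2)[OF 4(4)])
        simp
    also have "(\<Sum>k<m. of_bool (a = k) * of_bool (k = b) :: real) = of_bool (a = b)"
      using 4 by (simp add: of_bool_def if_distrib[of "\<lambda>x. x * _"] cong: if_cong)
    also have "1 / r * (1 / r) + (of_bool (a = b) - c - c + real m * c * c) = of_bool (a = b)"
    proof -
      have "c * (r - 1) = 1 / r" using r by (simp add: c_def)
      then have "1 / r * (1 / r) = c * (r - 1) / r" by simp
      also have "\<dots> = c - c / r" using r by (simp add: field_simps)
      finally have "1 / r * (1 / r) = c - c / r" .
      moreover have "real m * c * c = c + c / r" unfolding m using r by (simp add: field_simps)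
      ultimately show ?thesis by linarith
    qed
    finally show ?thesis using 4 by simp
  qed
qed

lemma spread_entry_isometry:
  fixes g :: "nat \<Rightarrow> real"
  shows "(\<Sum>i<n. (\<Sum>k<n. spread_entry n i k * g k)\<^sup>2) = (\<Sum>k<n. (g k)\<^sup>2)"
proof -
  have "(\<Sum>i<n. (\<Sum>k<n. spread_entry n i k * g k)\<^sup>2)
      = (\<Sum>i<n. \<Sum>k<n. \<Sum>l<n. g k * g l * (spread_entry n k i * spread_entry n i l))"
    by (intro sum.cong refl) (simp add: power2_eq_square sum_product spread_entry_sym mult_ac)
  also have "\<dots> = (\<Sum>k<n. \<Sum>l<n. \<Sum>i<n. g k * g l * (spread_entry n k i * spread_entry n i l))"
    by (subst sum.swap) (intro sum.cong refl sum.swap)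
  also have "\<dots> = (\<Sum>k<n. \<Sum>l<n. g k * g l * of_bool (k = l))"
    by (simp add: sum_distrib_left[symmetric] spread_entry_orthogonal)
  also have "\<dots> = (\<Sum>k<n. (g k)\<^sup>2)"
    by (intro sum.cong refl) (simp add: of_bool_def if_distrib[of "\<lambda>x. _ * x"] power2_eq_square cong: if_cong)
  finally show ?thesis .
qed

section \<open>Unitaries and measurement of the quantum automaton\<close>

lemma mat_adjoint_index:
  "i < dim_col A \<Longrightarrow> j < dim_row A \<Longrightarrow> mat_adjoint A $$ (i, j) = conjugate (A $$ (j, i))"
  unfolding mat_adjoint_def by (subst mat_of_rows_index) auto

lemma mat_adjoint_eq_self:
  assumes "A \<in> carrier_mat d d" "\<And>i j. i < d \<Longrightarrow> j < d \<Longrightarrow> conjugate (A $$ (j, i)) = A $$ (i, j)"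
  shows "mat_adjoint A = A"
  using assms by (intro eq_matI) (auto simp: mat_adjoint_index, auto simp: mat_adjoint_def)

text \<open>All operations of the automaton are Hermitian involutions, so a single product has to be
  computed.\<close>

lemma unitary_opI:
  assumes "U \<in> carrier_mat d d" "\<And>i j. i < d \<Longrightarrow> j < d \<Longrightarrow> conjugate (U $$ (j, i)) = U $$ (i, j)"
    and "U * U = 1\<^sub>m d"
  shows "unitary_op d U"
  using assms mat_adjoint_eq_self[OF assms(1,2)] by (simp add: unitary_op_def)

definition spread :: "nat \<Rightarrow> complex mat" where
  "spread n = mat n n (\<lambda>(i, j). complex_of_real (spread_entry n i j))"

lemma unitary_spread: "unitary_op n (spread n)"
proof (rule unitary_opI)
  show "spread n * spread n = 1\<^sub>m n"
  proof (rule eq_matI)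
    fix i j assume "i < dim_row (1\<^sub>m n)" "j < dim_col (1\<^sub>m n)"
    then have ij: "i < n" "j < n" by auto
    then have "(spread n * spread n) $$ (i, j)
        = complex_of_real (\<Sum>k<n. spread_entry n i k * spread_entry n k j)"
      by (simp add: spread_def scalar_prod_def lessThan_atLeast0)
    then show "(spread n * spread n) $$ (i, j) = 1\<^sub>m n $$ (i, j)"
      using ij by (simp add: spread_entry_orthogonal)
  qed (auto simp: spread_def)
qed (auto simp: spread_def spread_entry_sym)

lemma spread_mult_vec:
  "spread n *\<^sub>v vec n (\<lambda>i. complex_of_real (g i))
     = vec n (\<lambda>i. complex_of_real (\<Sum>k<n. spread_entry n i k * g k))"
  by (intro eq_vecI) (auto simp: spread_def scalar_prod_def lessThan_atLeast0)

text \<open>For \<open>t \<ge> n\<close> this is the identity, so indices out of range, which some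
  classical states produce, are harmless.\<close>

definition phase_flip :: "nat \<Rightarrow> nat \<Rightarrow> complex mat" where
  "phase_flip n t = mat_diag n (\<lambda>i. if i = t then - 1 else 1)"

lemma mat_diag_mult_vec: "mat_diag n f *\<^sub>v vec n g = vec n (\<lambda>i. f i * (g i :: 'a :: comm_semiring_1))"
proof (intro eq_vecI)
  fix i assume "i < dim_vec (vec n (\<lambda>i. f i * g i))"
  then show "(mat_diag n f *\<^sub>v vec n g) $ i = vec n (\<lambda>i. f i * g i) $ i"
    by (simp add: mat_diag_def scalar_prod_def if_distrib[of "\<lambda>x. x * _"] cong: if_cong)
qed (simp add: mat_diag_def)

lemma unitary_phase_flip: "unitary_op n (phase_flip n t)"
proof (rule unitary_opI)
  have "phase_flip n t * phase_flip n t = mat_diag n (\<lambda>i. 1)"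
    unfolding phase_flip_def mat_diag_diag by (rule arg_cong[of _ _ "mat_diag n"]) auto
  then show "phase_flip n t * phase_flip n t = 1\<^sub>m n" by simp
qed (auto simp: phase_flip_def mat_diag_def)

text \<open>As \<open>spread\<close> is its own inverse, applying it at the right end-marker turns
  the overlap with the uniform superposition into the amplitude of basis state 0, which is what is
  tested.\<close>

definition zero_test :: "nat \<Rightarrow> nat \<Rightarrow> complex mat" where
  "zero_test n r = mat_diag n (\<lambda>i. of_bool (i = 0 \<longleftrightarrow> r = 0))"

lemma projective_measurement_zero_test: "projective_measurement n {0, 1} (zero_test n)"
proof -
  have "projection_op n (zero_test n r)" for r
    unfolding projection_op_def
  proof (intro conjI mat_adjoint_eq_self)
    show "zero_test n r * zero_test n r = zero_test n r"
      by (simp add: zero_test_def flip: of_bool_conj)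
  qed (auto simp: zero_test_def mat_diag_def)
  moreover have "zero_test n r * zero_test n r' = 0\<^sub>m n n" if "(r = 0) \<noteq> (r' = 0)" for r r'
    unfolding zero_test_def mat_diag_diag using that by (intro eq_matI) (auto simp: mat_diag_def)
  moreover have "mat n n (\<lambda>(i, j). \<Sum>r\<in>{0, 1}. zero_test n r $$ (i, j)) = 1\<^sub>m n"
    by (intro eq_matI) (auto simp: zero_test_def mat_diag_def)
  ultimately show ?thesis by (auto simp: projective_measurement_def)
qed

lemma outcome_prob_zero_test:
  "outcome_prob (zero_test n r) (vec n (\<lambda>i. complex_of_real (g i)))
     = (\<Sum>i<n. of_bool (i = 0 \<longleftrightarrow> r = 0) * (g i)\<^sup>2)"
proof -
  let ?v = "vec n (\<lambda>i. of_bool (i = 0 \<longleftrightarrow> r = 0) * complex_of_real (g i))"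
  have "?v \<bullet>c ?v = (\<Sum>i<n. ?v $ i * cnj (?v $ i))"
    by (simp add: scalar_prod_def lessThan_atLeast0)
  also have "\<dots> = (\<Sum>i<n. complex_of_real (of_bool (i = 0 \<longleftrightarrow> r = 0) * (g i)\<^sup>2))"
    by (rule sum.cong) (auto simp: of_bool_def power2_eq_square)
  finally show ?thesis
    unfolding outcome_prob_def zero_test_def mat_diag_mult_vec by (simp flip: of_real_sum)
qed

section \<open>Construction and correctness of the quantum automaton\<close>

text \<open>The classical state counts the scanned symbols up to \<open>2 n + 3\<close>; the last two states are the
  accepting and the rejecting one. The \<open>i\<close>-th letters of \<open>x\<close> and \<open>y\<close>, counted from \<open>0\<close>, are scanned
  in the states \<open>i + 1\<close> and \<open>n + 2 + i\<close>.\<close>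

definition eq_qcfa :: "nat \<Rightarrow> symb qcfa" where
  "eq_qcfa n = \<lparr>
     q_dim = n,
     c_states = {..2 * n + 5},
     c_acc = {2 * n + 4},
     c_rej = {2 * n + 5},
     q_init = 0,
     c_init = 0,
     q_theta = (\<lambda>s \<sigma>. case \<sigma> of
         Letter a \<Rightarrow> if a = One then phase_flip n (if s \<le> n then s - 1 else s - n - 2) else 1\<^sub>m n
       | _ \<Rightarrow> spread n),
     c_delta = (\<lambda>s \<sigma>. min (Suc s) (2 * n + 5)),
     q_outcomes = (\<lambda>s. {0, 1}),
     q_proj = (\<lambda>s. zero_test n),
     c_final = (\<lambda>s r. if r = 0 then 2 * n + 4 else 2 * n + 5)\<rparr>"

lemma qcfa_eq_qcfa:
  assumes "n \<ge> 1"
  shows "qcfa (eq_qcfa n)"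
proof -
  have "unitary_op n (1\<^sub>m n)" by (rule unitary_opI) auto
  with assms show ?thesis
    by (auto simp: qcfa_def eq_qcfa_def projective_measurement_zero_test[simplified] unitary_spread
        unitary_phase_flip split: tape_symbol.split)
qed

text \<open>The two values of \<open>p\<close> are the states in which \<open>x\<close> and
  \<open>y\<close> begin. The induction appends letters, because the last one is scanned in state
  \<open>p + length xs\<close> and so flips index \<open>length xs\<close>. Arbitrary
  \<open>g\<close> allows the two runs to be chained.\<close>

lemma run_letters:
  assumes "p = 1 \<or> p = n + 2" "length xs \<le> n"
  shows "foldl (qcfa_step (eq_qcfa n)) (p, vec n (\<lambda>i. complex_of_real (g i))) (map Letter xs)
    = (p + length xs, vec n (\<lambda>i. complex_of_real (if i < length xs \<and> xs ! i = One then - g i else g i)))"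
  using assms(2)
proof (induction xs rule: rev_induct)
  case (snoc a xs)
  have "phase_flip n (length xs) *\<^sub>v vec n (\<lambda>i. complex_of_real (if i < length xs \<and> xs ! i = One then - g i else g i))
    = vec n (\<lambda>i. complex_of_real (if i < Suc (length xs) \<and> (xs @ [One]) ! i = One then - g i else g i))"
    unfolding phase_flip_def mat_diag_mult_vec
    by (intro eq_vecI) (auto simp: nth_append less_Suc_eq)
  moreover have "vec n (\<lambda>i. complex_of_real (if i < length xs \<and> xs ! i = One then - g i else g i))
    = vec n (\<lambda>i. complex_of_real (if i < Suc (length xs) \<and> (xs @ [a]) ! i = One then - g i else g i))" if "a \<noteq> One"
    using that by (intro eq_vecI) (auto simp: nth_append less_Suc_eq)
  ultimately show ?case
    using snoc assms(1) by (auto simp: qcfa_step_def eq_qcfa_def)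
qed simp

text \<open>For bits this is the product of the two phases contributed by \<open>x\<close> and
  \<open>y\<close>.\<close>

definition agreement_sign :: "symb list \<Rightarrow> symb list \<Rightarrow> nat \<Rightarrow> real" where
  "agreement_sign x y i = (if x ! i \<noteq> y ! i then - 1 else 1)"

lemma qcfa_run_eq_qcfa:
  assumes "n \<ge> 1" "x \<in> bitstrings n" "y \<in> bitstrings n"
  shows "qcfa_run (eq_qcfa n) (x @ [Hash] @ y) =
    (2 * n + 3, vec n (\<lambda>i. complex_of_real (\<Sum>k<n. spread_entry n i k * (agreement_sign x y k / sqrt n))))"
proof -
  let ?step = "qcfa_step (eq_qcfa n)"
  have len: "length x = n" "length y = n" using assms by (auto simp: bitstrings_def)
  have bits: "x ! i = Zero \<or> x ! i = One" "y ! i = Zero \<or> y ! i = One" if "i < n" for i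
  proof -
    have "x ! i \<in> set x" "y ! i \<in> set y" using that len by simp_all
    then show "x ! i = Zero \<or> x ! i = One" "y ! i = Zero \<or> y ! i = One"
      using assms(2,3) by (auto simp: bitstrings_def)
  qed
  have "spread n *\<^sub>v unit_vec n 0 = vec n (\<lambda>i. complex_of_real (1 / sqrt n))"
    using assms(1) by (intro eq_vecI) (auto simp: spread_def spread_entry_def)
  then have 1: "?step (c_init (eq_qcfa n), unit_vec (q_dim (eq_qcfa n)) (q_init (eq_qcfa n))) Left_End
      = (1, vec n (\<lambda>i. complex_of_real (1 / sqrt n)))"
    by (simp add: qcfa_step_def eq_qcfa_def)
  have 2: "?step (1 + n, vec n v) (Letter Hash) = (n + 2, vec n v)" for v
    by (simp add: qcfa_step_def eq_qcfa_def)
  have 3: "?step (n + 2 + n, vec n (\<lambda>i. complex_of_real (g i))) Right_End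
      = (2 * n + 3, vec n (\<lambda>i. complex_of_real (\<Sum>k<n. spread_entry n i k * g k)))" for g
    by (simp add: qcfa_step_def eq_qcfa_def spread_mult_vec)
  have "qcfa_run (eq_qcfa n) (x @ [Hash] @ y) =
    (2 * n + 3, vec n (\<lambda>i. complex_of_real (\<Sum>k<n. spread_entry n i k *
       (if k < length y \<and> y ! k = One then - (if k < length x \<and> x ! k = One then - (1 / sqrt n) else 1 / sqrt n)
        else if k < length x \<and> x ! k = One then - (1 / sqrt n) else 1 / sqrt n))))"
    unfolding qcfa_run_def tape_def
    using run_letters[of 1 n x] run_letters[of "n + 2" n y] len
    by (simp only: foldl_Cons foldl_Nil foldl_append map_append list.map append_Cons append_Nil append_assoc 1 2 3 order_refl simp_thms)
  \<comment> \<open>Two flips of the same index cancel, and each letter is \<open>Zero\<close> or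
    \<open>One\<close>, so exactly the disagreements keep a minus sign.\<close>
  also have "\<dots> = (2 * n + 3, vec n (\<lambda>i. complex_of_real (\<Sum>k<n. spread_entry n i k * (agreement_sign x y k / sqrt n))))"
    using len bits by (intro arg_cong2[of _ _ _ _ Pair] refl arg_cong2[of _ _ _ _ vec] ext arg_cong[of _ _ complex_of_real] sum.cong)
      (fastforce simp: agreement_sign_def)
  finally show ?thesis .
qed

text \<open>The final amplitude of basis state 0 is 1 for equal strings and 0 at distance
  \<open>n / 2\<close>. As \<open>spread\<close> preserves the norm, the rejection probability is
  the complement of its square.\<close>

lemma eq_qcfa_exact:
  assumes n: "n \<ge> 1"
  shows "qcfa_exactly_solves (eq_qcfa n) (A_EQ n)"
proof -
  have main: "(\<Sum>i<n. (w i)\<^sup>2) = 1 \<and> w 0 = 1 - 2 * real (hamming_dist x y) / n \<and>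
     qcfa_accept_prob (eq_qcfa n) (x @ [Hash] @ y) = (w 0)\<^sup>2 \<and>
     qcfa_reject_prob (eq_qcfa n) (x @ [Hash] @ y) = 1 - (w 0)\<^sup>2"
    if "x \<in> bitstrings n" "y \<in> bitstrings n"
      "w = (\<lambda>i. \<Sum>k<n. spread_entry n i k * (agreement_sign x y k / sqrt n))" for x y w
  proof -
    have sq: "(agreement_sign x y i / sqrt n)\<^sup>2 = 1 / n" for i
      by (simp add: agreement_sign_def power_divide)
    have norm: "(\<Sum>i<n. (w i)\<^sup>2) = 1"
      unfolding that(3) spread_entry_isometry sq using n by simp
    \<comment> \<open>Row 0 of \<open>spread\<close> is constant, so this amplitude is the average
      of the signs.\<close>
    have "w 0 = (\<Sum>k<n. agreement_sign x y k) / n"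
      by (simp add: that(3) spread_entry_def sum_divide_distrib)
    also have "(\<Sum>k<n. agreement_sign x y k) = (\<Sum>k<n. 1 - 2 * of_bool (x ! k \<noteq> y ! k))"
      by (intro sum.cong) (auto simp: agreement_sign_def)
    also have "\<dots> = real n - 2 * (\<Sum>k<n. of_bool (x ! k \<noteq> y ! k))"
      by (simp only: sum_subtractf sum_distrib_left[symmetric]) simp
    also have "(\<Sum>k<n. of_bool (x ! k \<noteq> y ! k) :: real) = real (hamming_dist x y)"
      using that(1) by (simp add: hamming_dist_def bitstrings_def sum_of_bool_eq lessThan_def Collect_conj_eq[symmetric])
    finally have w0: "w 0 = 1 - 2 * real (hamming_dist x y) / n"
      using n by (simp add: field_simps)
    have split: "(\<Sum>i<n. of_bool (i \<noteq> 0) * (w i)\<^sup>2) = 1 - (w 0)\<^sup>2"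
      "(\<Sum>i<n. of_bool (i = 0) * (w i)\<^sup>2) = (w 0)\<^sup>2"
      using norm n by (cases n; simp add: sum.lessThan_Suc_shift del: sum.lessThan_Suc)+
    have acc: "{r \<in> q_outcomes (eq_qcfa n) s. c_final (eq_qcfa n) s r \<in> c_acc (eq_qcfa n)} = {0}"
      and rej: "{r \<in> q_outcomes (eq_qcfa n) s. c_final (eq_qcfa n) s r \<in> c_rej (eq_qcfa n)} = {1}"
      and proj: "q_proj (eq_qcfa n) s = zero_test n" for s
      by (auto simp: eq_qcfa_def)
    have run: "qcfa_run (eq_qcfa n) (x @ [Hash] @ y) = (2 * n + 3, vec n (\<lambda>i. complex_of_real (w i)))"
      unfolding that(3) by (rule qcfa_run_eq_qcfa[OF n that(1,2)])
    have outcome: "outcome_prob (zero_test n 0) (vec n (\<lambda>i. complex_of_real (w i))) = (w 0)\<^sup>2"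
      "outcome_prob (zero_test n 1) (vec n (\<lambda>i. complex_of_real (w i))) = 1 - (w 0)\<^sup>2"
      unfolding outcome_prob_zero_test using split by simp_all
    show ?thesis
      unfolding qcfa_accept_prob_def qcfa_reject_prob_def qcfa_prob_def run prod.case Let_def acc rej proj
      using norm w0 outcome by simp
  qed
  have "qcfa_accept_prob (eq_qcfa n) w = 1" if yes: "w \<in> eq_yes n" for w
  proof -
    obtain x where x: "x \<in> bitstrings n" "w = x @ [Hash] @ x" using yes by (auto simp: eq_yes_def)
    then show ?thesis using main[OF x(1) x(1) refl] by (simp add: hamming_dist_def)
  qed
  moreover have "qcfa_reject_prob (eq_qcfa n) w = 1" if no: "w \<in> eq_no n" for w
  proof -
    obtain x y where x: "x \<in> bitstrings n" "y \<in> bitstrings n" "w = x @ [Hash] @ y"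
      "real (hamming_dist x y) = real n / 2" using no by (auto simp: eq_no_def)
    then show ?thesis using main[OF x(1,2) refl] n by simp
  qed
  ultimately show ?thesis by (simp add: qcfa_exactly_solves_def A_EQ_def)
qed

theorem theorem1:
  shows
    "(\<exists>\<A> :: nat \<Rightarrow> symb qcfa.
        (\<forall>n\<ge>1. qcfa (\<A> n) \<and> qcfa_exactly_solves (\<A> n) (A_EQ n) \<and> q_dim (\<A> n) = n) \<and>
        (\<lambda>n. real (card (c_states (\<A> n)))) \<in> O(\<lambda>n. real n)) \<and>
     (\<exists>c::real. c > 0 \<and>
        (\<forall>\<^sub>F n in sequentially. 4 dvd n \<longrightarrow>
           (\<forall>M :: symb dfa. dfa M \<and> dfa_solves M (A_EQ n) \<longrightarrow>
              real (card (dfa_states M)) \<ge> 2 powr (c * real n))))"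
proof
  have "(\<lambda>n. real (card (c_states (eq_qcfa n)))) \<in> O(\<lambda>n. real n)"
  \<comment> \<open>There are \<open>2 * n + 6\<close> classical states, at most
    \<open>8 * n\<close> once \<open>n \<ge> 1\<close>.\<close>
  proof (rule bigoI[of _ 8])
    show "\<forall>\<^sub>F n in sequentially. norm (real (card (c_states (eq_qcfa n)))) \<le> 8 * norm (real n)"
      using eventually_ge_at_top[of 1] by eventually_elim (simp add: eq_qcfa_def)
  qed
  moreover have "q_dim (eq_qcfa n) = n" for n by (simp add: eq_qcfa_def)
  ultimately show "\<exists>\<A> :: nat \<Rightarrow> symb qcfa.
        (\<forall>n\<ge>1. qcfa (\<A> n) \<and> qcfa_exactly_solves (\<A> n) (A_EQ n) \<and> q_dim (\<A> n) = n) \<and>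
        (\<lambda>n. real (card (c_states (\<A> n)))) \<in> O(\<lambda>n. real n)"
    using qcfa_eq_qcfa eq_qcfa_exact by blast
qed (rule dfa_exponential)

end
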